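(* Let $k$ be an ordered field and $G$ a nontrivial (totally) ordered abelian group. Let $<$ be any field order on the power series field $K=k((G))$. Then the ordered field $(K,<)$ does not admit any compatible exponential. Moreover, if $(k,<)$ is archimedean (where $k$ carries the order induced by $<$), then $(K,<)$ admits no exponential at all.
   Context: The (generalized) power series field $k((G))$ consists of all formal sums $\sum_{g\in G}a_g t^g$ with $a_g\in k$ and well ordered support $\{g\in G\mid a_g\neq 0\}$, with the usual addition and multiplication. Its canonical valuation $w$ sends a nonzero series to the least element of its support; it has value group $G$ and residue field $k$. It is convex with respect to every field order $<$ on $K=k((G))$, so $<$ induces an order on the residue field $k$ (this is the restriction of $<$ to the subfield $k$ of constants). An exponential on an ordered field $(K,<)$ is an isomorphism $f$ of ordered groups from $(K,+,0,<)$ onto the ordered multiplicative group $(K^{>0},\cdot,1,<)$ of positive elements. For $K=k((G))$ with canonical valuation $w$, let $R_w=\{a\in K\mid wa\geq 0\}$, $I_w=\{a\in K\mid wa>0\}$ and ${\mathcal U}_w^{>0}=\{a\in K\mid wa=0,\ a>0\}$. An exponential $f$ on $(K,<)$ is compatible if it induces an exponential on $k$ through the canonical residue map, that is, if $f(R_w)={\mathcal U}_w^{>0}$ and $f(I_w)=1+I_w$. *)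

theory Defs
  imports Complex_Main "HOL-Library.Extended"
begin

lemma wfp_on_less_iff:
  fixes A :: "'a::linorder set"
  shows "wfp_on A (<) \<longleftrightarrow> (\<forall>B\<subseteq>A. B \<noteq> {} \<longrightarrow> (\<exists>z\<in>B. \<forall>y\<in>B. z \<le> y))"
  unfolding wfp_on_iff_ex_minimal by (metis not_less)

lemma wfp_on_less_obtain_least:
  fixes A :: "'a::linorder set"
  assumes "wfp_on A (<)" "B \<subseteq> A" "B \<noteq> {}"
  obtains z where "z \<in> B" "\<And>y. y \<in> B \<Longrightarrow> z \<le> y"
  using assms wfp_on_less_iff by metis

lemma wfp_on_less_Un:
  fixes A B :: "'a::linorder set"
  assumes A: "wfp_on A (<)" and B: "wfp_on B (<)"
  shows "wfp_on (A \<union> B) (<)"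
  unfolding wfp_on_less_iff
proof (intro allI impI)
  fix C assume C: "C \<subseteq> A \<union> B" "C \<noteq> {}"
  show "\<exists>z\<in>C. \<forall>y\<in>C. z \<le> y"
  proof (cases "C \<inter> A = {} \<or> C \<inter> B = {}")
    case True
    then have "C \<subseteq> A \<or> C \<subseteq> B" using C by blast
    then show ?thesis using A B C unfolding wfp_on_less_iff by blast
  next
    case False
    obtain a where a: "a \<in> C \<inter> A" "\<And>y. y \<in> C \<inter> A \<Longrightarrow> a \<le> y"
      using wfp_on_less_obtain_least[OF A, of "C \<inter> A"] False by blast
    obtain b where b: "b \<in> C \<inter> B" "\<And>y. y \<in> C \<inter> B \<Longrightarrow> b \<le> y"
      using wfp_on_less_obtain_least[OF B, of "C \<inter> B"] False by blast
    have "min a b \<in> C" using a b by (auto simp: min_def)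
    moreover have "\<forall>y\<in>C. min a b \<le> y" using a(2) b(2) C(1) by (auto simp: min_le_iff_disj)
    ultimately show ?thesis by blast
  qed
qed

lemma wfp_on_less_sum:
  fixes A B :: "'a::linordered_ab_group_add set"
  assumes A: "wfp_on A (<)" and B: "wfp_on B (<)"
  shows "wfp_on {x + y | x y. x \<in> A \<and> y \<in> B} (<)"
  unfolding wfp_on_less_iff
proof (intro allI impI, rule ccontr)
  fix S assume S: "S \<subseteq> {x + y | x y. x \<in> A \<and> y \<in> B}" "S \<noteq> {}"
  assume nomin: "\<not> (\<exists>z\<in>S. \<forall>y\<in>S. z \<le> y)"
  define P where "P c a \<longleftrightarrow> a \<in> A \<and> (\<exists>b\<in>B. a + b \<in> S \<and> a + b \<le> c)" for c a
  define m where "m c = (LEAST a. P c a)" for c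
  have m: "P c (m c) \<and> (\<forall>a. P c a \<longrightarrow> m c \<le> a)" if c: "c \<in> S" for c
  proof -
    have ne: "Collect (P c) \<noteq> {}" using S(1) c unfolding P_def by fastforce
    have sub: "Collect (P c) \<subseteq> A" by (auto simp: P_def)
    obtain a where a: "P c a" "\<And>y. P c y \<Longrightarrow> a \<le> y"
      using wfp_on_less_obtain_least[OF A sub ne] by auto
    have "m c = a" unfolding m_def by (rule Least_equality) (use a in auto)
    then show ?thesis using a by auto
  qed
  define T where "T = {b\<in>B. \<exists>c\<in>S. m c + b \<in> S \<and> m c + b \<le> c}"
  have T: "\<exists>b\<in>B. m c + b \<in> S \<and> m c + b \<le> c" if "c \<in> S" for c
    using m[OF that] by (auto simp: P_def)
  have "T \<noteq> {}" using S(2) T unfolding T_def by blast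
  moreover have "T \<subseteq> B" by (auto simp: T_def)
  ultimately obtain b where b: "b \<in> T" "\<And>y. y \<in> T \<Longrightarrow> b \<le> y"
    using wfp_on_less_obtain_least[OF B] by metis
  obtain c where c: "c \<in> S" "m c + b \<in> S" "m c + b \<le> c" using b(1) by (auto simp: T_def)
  obtain d where d: "d \<in> S" "d < m c + b" using nomin c(2) by (meson not_le)
  obtain b' where b': "b' \<in> B" "m d + b' \<in> S" "m d + b' \<le> d" using T[OF d(1)] by blast
  have "b' \<in> T" using b' d(1) by (auto simp: T_def)
  have "P c (m d)"
    using m[OF d(1)] d(2) c(3) unfolding P_def by force
  then have "m c \<le> m d" using m[OF c(1)] by blast
  have "m d + b' < m c + b" using b'(3) d(2) by simp
  also have "\<dots> \<le> m d + b" using \<open>m c \<le> m d\<close> by simp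
  finally have "b' < b" by simp
  then show False using b(2)[OF \<open>b' \<in> T\<close>] by simp
qed

lemma finite_if_wfp_on_less_greater:
  fixes S :: "'a::linorder set"
  assumes lt: "wfp_on S (<)" and gt: "\<And>B. B \<subseteq> S \<Longrightarrow> B \<noteq> {} \<Longrightarrow> \<exists>z\<in>B. \<forall>y\<in>B. y \<le> z"
  shows "finite S"
proof -
  define T where "T = {x\<in>S. infinite {y\<in>S. y \<le> x}}"
  have "T = {}"
  proof (rule ccontr)
    assume "T \<noteq> {}"
    moreover have "T \<subseteq> S" by (auto simp: T_def)
    ultimately obtain m where m: "m \<in> T" "\<And>y. y \<in> T \<Longrightarrow> m \<le> y"
      using wfp_on_less_obtain_least[OF lt] by metis
    have eq: "{y\<in>S. y \<le> m} = insert m {y\<in>S. y < m}" using m(1) by (auto simp: T_def)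
    then have inf: "infinite {y\<in>S. y < m}" using m(1) by (auto simp: T_def)
    then have "{y\<in>S. y < m} \<noteq> {}" by (metis finite.emptyI)
    then obtain p where p: "p \<in> {y\<in>S. y < m}" "\<forall>y\<in>{y\<in>S. y < m}. y \<le> p"
      using gt[of "{y\<in>S. y < m}"] by auto
    have "p \<notin> T" using p(1) m(2) by force
    then have "finite {y\<in>S. y \<le> p}" using p(1) by (auto simp: T_def)
    moreover have "{y\<in>S. y < m} \<subseteq> {y\<in>S. y \<le> p}" using p by auto
    ultimately show False using inf finite_subset by blast
  qed
  show ?thesis
  proof (cases "S = {}")
    case False
    then obtain M where M: "M \<in> S" "\<forall>y\<in>S. y \<le> M" using gt[of S] by auto
    then have "{y\<in>S. y \<le> M} = S" by auto
    moreover have "M \<notin> T" using \<open>T = {}\<close> by simp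
    ultimately show ?thesis using M(1) by (simp add: T_def)
  qed simp
qed

definition sum_pairs :: "'g::linordered_ab_group_add set \<Rightarrow> 'g set \<Rightarrow> 'g \<Rightarrow> ('g \<times> 'g) set" where
  "sum_pairs A B g = {(x, y). x \<in> A \<and> y \<in> B \<and> x + y = g}"

lemma finite_sum_pairs:
  assumes A: "wfp_on A (<)" and B: "wfp_on B (<)"
  shows "finite (sum_pairs A B g)"
proof -
  define S where "S = {x\<in>A. g - x \<in> B}"
  have "finite S"
  proof (rule finite_if_wfp_on_less_greater)
    show "wfp_on S (<)" by (rule wfp_on_subset[OF A]) (auto simp: S_def)
    fix C assume C: "C \<subseteq> S" "C \<noteq> {}"
    then have "(\<lambda>x. g - x) ` C \<subseteq> B" "(\<lambda>x. g - x) ` C \<noteq> {}" by (auto simp: S_def)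
    then obtain z where z: "z \<in> (\<lambda>x. g - x) ` C" "\<And>y. y \<in> (\<lambda>x. g - x) ` C \<Longrightarrow> z \<le> y"
      using wfp_on_less_obtain_least[OF B] by metis
    then obtain x where x: "x \<in> C" "z = g - x" by blast
    have "\<forall>y\<in>C. y \<le> x" using z(2) x by fastforce
    then show "\<exists>z\<in>C. \<forall>y\<in>C. y \<le> z" using x(1) by blast
  qed
  moreover have "sum_pairs A B g \<subseteq> (\<lambda>x. (x, g - x)) ` S"
    by (auto simp: sum_pairs_def S_def image_iff)
  ultimately show ?thesis by (meson finite_imageI finite_subset)
qed

typedef (overloaded) ('g, 'k) hahn =
  "{a :: 'g::linorder \<Rightarrow> 'k::zero. wfp_on {g. a g \<noteq> 0} (<)}"
  morphisms hcoeff Abs_hahn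
  by (rule exI[of _ "\<lambda>_. 0"]) (simp add: wfp_on_less_iff)

setup_lifting type_definition_hahn

definition hsupp :: "('g::linorder, 'k::zero) hahn \<Rightarrow> 'g set" where
  "hsupp a = {g. hcoeff a g \<noteq> 0}"

lemma wfp_on_hsupp: "wfp_on (hsupp a) (<)"
  using hcoeff[of a] by (simp add: hsupp_def)

lemma hahn_eqI: "(\<And>g. hcoeff a g = hcoeff b g) \<Longrightarrow> a = b"
  by (simp add: hcoeff_inject[symmetric] fun_eq_iff)

lemma not_in_hsupp: "g \<notin> hsupp a \<longleftrightarrow> hcoeff a g = 0"
  by (simp add: hsupp_def)

lift_definition hsingle :: "'g::linorder \<Rightarrow> 'k::zero \<Rightarrow> ('g, 'k) hahn" is
  "\<lambda>g c h. if h = g then c else 0"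
proof -
  fix g :: 'g and c :: 'k
  show "wfp_on {h. (if h = g then c else 0) \<noteq> 0} (<)"
    by (auto simp: wfp_on_less_iff split: if_splits)
qed

instantiation hahn :: (linordered_ab_group_add, field) comm_ring_1
begin

lift_definition zero_hahn :: "('a, 'b) hahn" is "\<lambda>_. 0" by (simp add: wfp_on_less_iff)

definition one_hahn :: "('a, 'b) hahn" where "1 = hsingle 0 1"

lift_definition plus_hahn :: "('a, 'b) hahn \<Rightarrow> ('a, 'b) hahn \<Rightarrow> ('a, 'b) hahn" is
  "\<lambda>a b g. a g + b g"
proof -
  fix a b :: "'a \<Rightarrow> 'b"
  assume "wfp_on {g. a g \<noteq> 0} (<)" "wfp_on {g. b g \<noteq> 0} (<)"
  then show "wfp_on {g. a g + b g \<noteq> 0} (<)"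
    by (rule wfp_on_subset[OF wfp_on_less_Un]) auto
qed

lift_definition uminus_hahn :: "('a, 'b) hahn \<Rightarrow> ('a, 'b) hahn" is "\<lambda>a g. - a g" by simp

lift_definition minus_hahn :: "('a, 'b) hahn \<Rightarrow> ('a, 'b) hahn \<Rightarrow> ('a, 'b) hahn" is
  "\<lambda>a b g. a g - b g"
proof -
  fix a b :: "'a \<Rightarrow> 'b"
  assume "wfp_on {g. a g \<noteq> 0} (<)" "wfp_on {g. b g \<noteq> 0} (<)"
  then show "wfp_on {g. a g - b g \<noteq> 0} (<)"
    by (rule wfp_on_subset[OF wfp_on_less_Un]) auto
qed

lift_definition times_hahn :: "('a, 'b) hahn \<Rightarrow> ('a, 'b) hahn \<Rightarrow> ('a, 'b) hahn" is
  "\<lambda>a b g. \<Sum>(x, y) | a x \<noteq> 0 \<and> b y \<noteq> 0 \<and> x + y = g. a x * b y"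
proof -
  fix a b :: "'a \<Rightarrow> 'b"
  assume wf: "wfp_on {g. a g \<noteq> 0} (<)" "wfp_on {g. b g \<noteq> 0} (<)"
  have "{g. (\<Sum>(x, y) | a x \<noteq> 0 \<and> b y \<noteq> 0 \<and> x + y = g. a x * b y) \<noteq> 0}
      \<subseteq> {x + y | x y. x \<in> {g. a g \<noteq> 0} \<and> y \<in> {g. b g \<noteq> 0}}"
    by (auto elim!: sum.not_neutral_contains_not_neutral)
  then show "wfp_on {g. (\<Sum>(x, y) | a x \<noteq> 0 \<and> b y \<noteq> 0 \<and> x + y = g. a x * b y) \<noteq> 0} (<)"
    using wfp_on_less_sum[OF wf] wfp_on_subset by blast
qed

lemma hcoeff_times:
  fixes a b :: "('a, 'b) hahn"
  assumes "wfp_on A (<)" "wfp_on B (<)" "hsupp a \<subseteq> A" "hsupp b \<subseteq> B"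
  shows "hcoeff (a * b) g = (\<Sum>(x, y)\<in>sum_pairs A B g. hcoeff a x * hcoeff b y)"
proof -
  have "hcoeff (a * b) g = (\<Sum>(x, y)\<in>sum_pairs (hsupp a) (hsupp b) g. hcoeff a x * hcoeff b y)"
    by (simp add: times_hahn.rep_eq sum_pairs_def hsupp_def)
  also have "\<dots> = (\<Sum>(x, y)\<in>sum_pairs A B g. hcoeff a x * hcoeff b y)"
    by (rule sum.mono_neutral_left[OF finite_sum_pairs[OF assms(1,2)]])
      (use assms(3,4) in \<open>auto simp: sum_pairs_def hsupp_def\<close>)
  finally show ?thesis .
qed

lemma hsupp_times: "hsupp (a * b :: ('a, 'b) hahn) \<subseteq> {x + y | x y. x \<in> hsupp a \<and> y \<in> hsupp b}"
  by (auto simp: hsupp_def times_hahn.rep_eq elim!: sum.not_neutral_contains_not_neutral)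

lemma hahn_mult_commute: "a * b = b * (a :: ('a, 'b) hahn)"
proof (rule hahn_eqI)
  fix g
  note ab = wfp_on_hsupp[of a] wfp_on_hsupp[of b]
  show "hcoeff (a * b) g = hcoeff (b * a) g"
    unfolding hcoeff_times[OF ab order.refl order.refl]
      hcoeff_times[OF ab(2,1) order.refl order.refl]
    by (rule sum.reindex_bij_witness[of _ prod.swap prod.swap])
      (auto simp: sum_pairs_def add.commute mult.commute)
qed

lemma hahn_distrib: "(a + b) * c = a * c + b * (c :: ('a, 'b) hahn)"
proof (rule hahn_eqI)
  fix g
  have A: "wfp_on (hsupp a \<union> hsupp b) (<)" by (intro wfp_on_less_Un wfp_on_hsupp)
  have s: "hsupp (a + b) \<subseteq> hsupp a \<union> hsupp b" by (auto simp: hsupp_def plus_hahn.rep_eq)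
  note t = hcoeff_times[OF A wfp_on_hsupp[of c] _ order.refl]
  show "hcoeff ((a + b) * c) g = hcoeff (a * c + b * c) g"
    by (simp add: t[OF s] t[of a] t[of b] plus_hahn.rep_eq sum.distrib[symmetric]
        distrib_right case_prod_unfold)
qed

lemma hahn_mult_assoc: "(a * b) * c = a * (b * (c :: ('a, 'b) hahn))"
proof (rule hahn_eqI)
  fix g
  let ?A = "hsupp a" and ?B = "hsupp b" and ?C = "hsupp c"
  define AB where "AB = {x + y | x y. x \<in> ?A \<and> y \<in> ?B}"
  define BC where "BC = {x + y | x y. x \<in> ?B \<and> y \<in> ?C}"
  have wAB: "wfp_on AB (<)" and wBC: "wfp_on BC (<)"
    unfolding AB_def BC_def by (intro wfp_on_less_sum wfp_on_hsupp)+
  have sAB: "hsupp (a * b) \<subseteq> AB" and sBC: "hsupp (b * c) \<subseteq> BC"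
    unfolding AB_def BC_def by (rule hsupp_times)+
  note w = wfp_on_hsupp
  have "hcoeff ((a * b) * c) g =
      (\<Sum>p\<in>sum_pairs AB ?C g. \<Sum>q\<in>sum_pairs ?A ?B (fst p).
        hcoeff a (fst q) * hcoeff b (snd q) * hcoeff c (snd p))"
    unfolding hcoeff_times[OF wAB w[of c] sAB order.refl]
    by (simp add: hcoeff_times[OF w[of a] w[of b] order.refl order.refl]
        case_prod_unfold sum_distrib_right)
  also have "\<dots> = (\<Sum>(p, q)\<in>(SIGMA p:sum_pairs AB ?C g. sum_pairs ?A ?B (fst p)).
        hcoeff a (fst q) * hcoeff b (snd q) * hcoeff c (snd p))"
    by (rule sum.Sigma) (auto intro: finite_sum_pairs wAB w)
  also have "\<dots> = (\<Sum>(p, q)\<in>(SIGMA p:sum_pairs ?A BC g. sum_pairs ?B ?C (snd p)).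
        hcoeff a (fst p) * (hcoeff b (fst q) * hcoeff c (snd q)))"
    by (rule sum.reindex_bij_witness[of _
          "\<lambda>((x, u), (y, z)). ((x + y, z), (x, y))" "\<lambda>((u, z), (x, y)). ((x, y + z), (y, z))"])
      (auto simp: sum_pairs_def AB_def BC_def add.assoc mult.assoc)
  also have "\<dots> = (\<Sum>p\<in>sum_pairs ?A BC g. \<Sum>q\<in>sum_pairs ?B ?C (snd p).
        hcoeff a (fst p) * (hcoeff b (fst q) * hcoeff c (snd q)))"
    by (rule sum.Sigma[symmetric]) (auto intro: finite_sum_pairs wBC w)
  also have "\<dots> = hcoeff (a * (b * c)) g"
    unfolding hcoeff_times[OF w[of a] wBC order.refl sBC]
    by (simp add: hcoeff_times[OF w[of b] w[of c] order.refl order.refl]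
        case_prod_unfold sum_distrib_left)
  finally show "hcoeff ((a * b) * c) g = hcoeff (a * (b * c)) g" .
qed

lemma hcoeff_times_hsingle:
  "hcoeff (a * hsingle s c) g = hcoeff a (g - s) * (c :: 'b)" for a :: "('a, 'b) hahn"
proof -
  have s: "hsupp (hsingle s c) \<subseteq> {s}" by (auto simp: hsupp_def hsingle.rep_eq)
  have w: "wfp_on {x :: 'a} (<)" for x by (auto simp: wfp_on_less_iff)
  note t = hcoeff_times[OF wfp_on_less_Un[OF wfp_on_hsupp[of a] w[of "g - s"]] w[of s] Un_upper1 s]
  have "sum_pairs (hsupp a \<union> {g - s}) {s} g = {(g - s, s)}"
    by (auto simp: sum_pairs_def)
  then show ?thesis by (simp add: t hsingle.rep_eq)
qed

instance
proof
  fix a b c :: "('a, 'b) hahn"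
  show "a + b + c = a + (b + c)" by transfer (simp add: add.assoc)
  show "a + b = b + a" by transfer (simp add: add.commute)
  show "0 + a = a" by transfer simp
  show "- a + a = 0" by transfer simp
  show "a - b = a + - b" by transfer simp
  show "a * b * c = a * (b * c)" by (rule hahn_mult_assoc)
  show "a * b = b * a" by (rule hahn_mult_commute)
  show "(a + b) * c = a * c + b * c" by (rule hahn_distrib)
  have "a * 1 = a" by (rule hahn_eqI) (simp add: one_hahn_def hcoeff_times_hsingle)
  then show "1 * a = a" by (simp add: hahn_mult_commute)
  have "hcoeff (0 :: ('a, 'b) hahn) 0 \<noteq> hcoeff 1 0"
    by (simp add: one_hahn_def hsingle.rep_eq zero_hahn.rep_eq)
  then show "(0 :: ('a, 'b) hahn) \<noteq> 1" by metis
qed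

end

lemma hcoeff_times_eq_0:
  fixes a b :: "('g::linordered_ab_group_add, 'k::field) hahn"
  assumes a: "\<And>x. x < u \<Longrightarrow> hcoeff a x = 0" and b: "\<And>y. y \<le> s \<Longrightarrow> hcoeff b y = 0"
    and g: "g \<le> u + s"
  shows "hcoeff (a * b) g = 0"
proof -
  have "g \<notin> hsupp (a * b)"
  proof
    assume "g \<in> hsupp (a * b)"
    then obtain x y where xy: "x \<in> hsupp a" "y \<in> hsupp b" "g = x + y"
      using hsupp_times by blast
    have "u \<le> x" using a[of x] xy(1) not_in_hsupp not_less by blast
    moreover have "s < y" using b[of y] xy(2) not_in_hsupp not_less by blast
    ultimately show False using g xy(3) add_le_less_mono by fastforce
  qed
  then show ?thesis by (simp add: hsupp_def)
qed

text \<open>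
  Inverses: a partial inverse \<open>h\<close> of \<open>a\<close> is one whose error \<open>1 - a * h\<close> vanishes up to every
  exponent that the support of \<open>h\<close> can influence; a maximal one under end extension is an inverse.
\<close>

lemma hahn_inverse_exists:
  fixes a :: "('g::linordered_ab_group_add, 'k::field) hahn"
  assumes "a \<noteq> 0"
  shows "\<exists>b. a * b = 1"
proof -
  have "hsupp a \<noteq> {}" using assms hahn_eqI[of a 0] by (auto simp: hsupp_def zero_hahn.rep_eq)
  then obtain u where u: "u \<in> hsupp a" "\<And>x. x \<in> hsupp a \<Longrightarrow> u \<le> x"
    using wfp_on_less_obtain_least[OF wfp_on_hsupp order.refl] by metis
  have u0: "hcoeff a u \<noteq> 0" using u(1) by (simp add: hsupp_def)
  have ua: "hcoeff a x = 0" if "x < u" for x using u(2)[of x] that not_in_hsupp not_less by blast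
  define D where "D h = 1 - a * h" for h
  define Q where
    "Q h h' \<longleftrightarrow> (\<forall>s. hcoeff h s \<noteq> 0 \<longrightarrow> (\<forall>x\<le>s. hcoeff h x = hcoeff h' x))"
    for h h' :: "('g, 'k) hahn"
  define X where "X = {h. \<forall>s. hcoeff h s \<noteq> 0 \<longrightarrow> (\<forall>x\<le>u + s. hcoeff (D h) x = 0)}"
  have agree: "hcoeff (D h) x = hcoeff (D h') x"
    if "\<And>y. y \<le> s \<Longrightarrow> hcoeff h y = hcoeff h' y" "x \<le> u + s" for h h' s x
  proof -
    have "hcoeff (a * (h - h')) x = 0"
      by (rule hcoeff_times_eq_0[OF ua _ that(2)]) (simp_all add: that(1) minus_hahn.rep_eq)
    then show ?thesis by (simp add: D_def right_diff_distrib minus_hahn.rep_eq)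
  qed
  have refl: "Q h h" for h by (simp add: Q_def)
  have trans: "Q h h''" if "Q h h'" "Q h' h''" for h h' h''
    using that unfolding Q_def by (metis order.refl)
  have antisym: "h = h'" if "Q h h'" "Q h' h" for h h'
    using that unfolding Q_def by (metis hahn_eqI order.refl)
  have "\<exists>m\<in>X. \<forall>h\<in>X. Q m h \<longrightarrow> h = m"
  proof (rule predicate_Zorn)
    show "partial_order_on X (relation_of Q X)"
      by (rule partial_order_on_relation_ofI) (use refl trans antisym in blast)+
    fix C assume "C \<in> Chains (relation_of Q X)"
    then have CX: "C \<subseteq> X" and ch: "\<And>h h'. h \<in> C \<Longrightarrow> h' \<in> C \<Longrightarrow> Q h h' \<or> Q h' h"
      by (auto simp: Chains_def relation_of_def)
    define v where
      "v x = (if \<exists>h\<in>C. hcoeff h x \<noteq> 0 then hcoeff (SOME h. h \<in> C \<and> hcoeff h x \<noteq> 0) x else 0)" for x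
    have v1: "v x = hcoeff h x" if h: "h \<in> C" "hcoeff h x \<noteq> 0" for h x
    proof -
      define h' where "h' = (SOME h. h \<in> C \<and> hcoeff h x \<noteq> 0)"
      have h': "h' \<in> C \<and> hcoeff h' x \<noteq> 0" unfolding h'_def by (rule someI[of _ h]) (use h in simp)
      have "v x = hcoeff h' x" using h by (auto simp: v_def h'_def)
      moreover have "hcoeff h' x = hcoeff h x" using ch[of h h'] h h' by (auto simp: Q_def)
      ultimately show ?thesis by simp
    qed
    have v2: "\<exists>h\<in>C. hcoeff h x \<noteq> 0" if "v x \<noteq> 0" for x using that by (auto simp: v_def split: if_splits)
    have v3: "v x = hcoeff h x" if h: "h \<in> C" "hcoeff h s \<noteq> 0" "x \<le> s" for h s x
    proof (cases "v x = 0")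
      case True
      then show ?thesis using v1[OF h(1)] by metis
    next
      case False
      then obtain h' where h': "h' \<in> C" "hcoeff h' x \<noteq> 0" using v2 by blast
      have "hcoeff h x = hcoeff h' x" using ch[OF h(1) h'(1)] h h'(2) unfolding Q_def by force
      then show ?thesis using v1[OF h'] by simp
    qed
    have "wfp_on {x. v x \<noteq> 0} (<)"
      unfolding wfp_on_less_iff
    proof (intro allI impI)
      fix S assume S: "S \<subseteq> {x. v x \<noteq> 0}" "S \<noteq> {}"
      then obtain s where s: "s \<in> S" by blast
      then obtain h where h: "h \<in> C" "hcoeff h s \<noteq> 0" using S v2 by blast
      have sub: "{x\<in>S. x \<le> s} \<subseteq> hsupp h" using S(1) v3[OF h] by (auto simp: hsupp_def)
      have ne: "{x\<in>S. x \<le> s} \<noteq> {}" using s by auto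
      obtain z where z: "z \<in> {x\<in>S. x \<le> s}" "\<And>y. y \<in> {x\<in>S. x \<le> s} \<Longrightarrow> z \<le> y"
        by (rule wfp_on_less_obtain_least[OF wfp_on_hsupp sub ne]) blast
      have "z \<le> y" if "y \<in> S" for y
      proof (cases "y \<le> s")
        case False
        then have "s \<le> y" by simp
        then show ?thesis using z(1) by (auto intro: order.trans)
      qed (use z(2) that in simp)
      then show "\<exists>z\<in>S. \<forall>y\<in>S. z \<le> y" using z(1) by blast
    qed
    then have V: "hcoeff (Abs_hahn v) = v" by (simp add: Abs_hahn_inverse)
    have QV: "Q h (Abs_hahn v)" if "h \<in> C" for h
      using v3[OF that] by (simp add: Q_def V)
    have "Abs_hahn v \<in> X"
      unfolding X_def
    proof (intro CollectI allI impI)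
      fix s x assume s: "hcoeff (Abs_hahn v) s \<noteq> 0" and x: "x \<le> u + s"
      obtain h where h: "h \<in> C" "hcoeff h s \<noteq> 0" using v2 s V by auto
      have "hcoeff (D (Abs_hahn v)) x = hcoeff (D h) x"
        by (rule agree[OF _ x]) (simp add: V v3[OF h])
      also have "\<dots> = 0" using CX h x by (auto simp: X_def)
      finally show "hcoeff (D (Abs_hahn v)) x = 0" .
    qed
    then show "\<exists>u\<in>X. \<forall>h\<in>C. Q h u" using QV by blast
  qed
  then obtain m where m: "m \<in> X" "\<And>h. h \<in> X \<Longrightarrow> Q m h \<Longrightarrow> h = m" by blast
  have "D m = 0"
  proof (rule ccontr)
    assume "D m \<noteq> 0"
    then have "hsupp (D m) \<noteq> {}" using hahn_eqI[of "D m" 0] by (auto simp: hsupp_def zero_hahn.rep_eq)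
    then obtain g where g: "g \<in> hsupp (D m)" "\<And>x. x \<in> hsupp (D m) \<Longrightarrow> g \<le> x"
      using wfp_on_less_obtain_least[OF wfp_on_hsupp order.refl] by metis
    define c where "c = hcoeff (D m) g / hcoeff a u"
    define m' where "m' = m + hsingle (g - u) c"
    have c: "c \<noteq> 0" using g(1) u0 by (simp add: c_def hsupp_def)
    have lt: "s < g - u" if "hcoeff m s \<noteq> 0" for s
    proof -
      have "\<not> g \<le> u + s" using m(1) that g(1) by (auto simp: X_def hsupp_def)
      then show ?thesis by (simp add: less_diff_eq add.commute)
    qed
    have m': "hcoeff m' x = hcoeff m x + (if x = g - u then c else 0)" for x
      by (simp add: m'_def plus_hahn.rep_eq hsingle.rep_eq)
    have Dm': "hcoeff (D m') x = 0" if "x \<le> g" for x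
    proof -
      have "D m' = D m - a * hsingle (g - u) c" by (simp add: D_def m'_def algebra_simps)
      then have e: "hcoeff (D m') x = hcoeff (D m) x - hcoeff a (x - (g - u)) * c"
        by (simp add: minus_hahn.rep_eq hcoeff_times_hsingle)
      show ?thesis
      proof (cases "x = g")
        case True
        then show ?thesis using e u0 by (simp add: c_def)
      next
        case False
        then have "x < g" using that by simp
        then have "hcoeff (D m) x = 0" using g(2)[of x] not_in_hsupp not_less by blast
        moreover have "x - (g - u) < u" using \<open>x < g\<close> by (simp add: algebra_simps)
        ultimately show ?thesis using e ua by simp
      qed
    qed
    have "m' \<in> X"
      unfolding X_def
    proof (intro CollectI allI impI)
      fix s x assume s: "hcoeff m' s \<noteq> 0" and x: "x \<le> u + s"
      have "s \<le> g - u" using s lt[of s] by (auto simp: m' split: if_splits)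
      then have "u + s \<le> g" by (simp add: le_diff_eq add.commute)
      then show "hcoeff (D m') x = 0" using Dm' x by simp
    qed
    moreover have "Q m m'" unfolding Q_def by (auto simp: m' dest: lt)
    ultimately have "m' = m" using m(2) by blast
    then show False using m'[of "g - u"] c by simp
  qed
  then show ?thesis by (auto simp: D_def)
qed

instantiation hahn :: (linordered_ab_group_add, field) field
begin

definition inverse_hahn :: "('a, 'b) hahn \<Rightarrow> ('a, 'b) hahn" where
  "inverse_hahn a = (if a = 0 then 0 else SOME b. a * b = 1)"

definition divide_hahn :: "('a, 'b) hahn \<Rightarrow> ('a, 'b) hahn \<Rightarrow> ('a, 'b) hahn" where
  "divide_hahn a b = a * inverse b"

instance
proof
  fix a b :: "('a, 'b) hahn"
  show "inverse a * a = 1" if "a \<noteq> 0"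
    using someI_ex[OF hahn_inverse_exists[OF that]] that by (simp add: inverse_hahn_def mult.commute)
  show "a div b = a * inverse b" by (rule divide_hahn_def)
  show "inverse (0 :: ('a, 'b) hahn) = 0" by (simp add: inverse_hahn_def)
qed

end

definition hconst :: "'k::zero \<Rightarrow> ('g::{linorder, zero}, 'k) hahn" where
  "hconst c = hsingle 0 c"

text \<open>The canonical valuation; its value at \<open>0\<close> is \<open>Pinf\<close>, and \<open>Minf\<close> is never attained.\<close>

definition hval :: "('g::linordered_ab_group_add, 'k::field) hahn \<Rightarrow> 'g extended" where
  "hval a = (if a = 0 then Pinf else Fin (LEAST g. g \<in> hsupp a))"

text \<open>
  The order on a power series field is arbitrary, so an order is passed as an explicit relation
  rather than through a type class.
\<close>

definition field_order :: "('a::field \<Rightarrow> 'a \<Rightarrow> bool) \<Rightarrow> bool" where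
  "field_order lt \<longleftrightarrow>
     class.linorder (\<lambda>x y. x = y \<or> lt x y) lt \<and>
     (\<forall>x y z. lt x y \<longrightarrow> lt (x + z) (y + z)) \<and>
     (\<forall>x y. lt 0 x \<longrightarrow> lt 0 y \<longrightarrow> lt 0 (x * y))"

definition archimedean_order :: "('a::field \<Rightarrow> 'a \<Rightarrow> bool) \<Rightarrow> bool" where
  "archimedean_order lt \<longleftrightarrow> (\<forall>x. \<exists>n::nat. lt x (of_nat n))"

definition constant_order ::
    "(('g::linordered_ab_group_add, 'k::field) hahn \<Rightarrow> ('g, 'k) hahn \<Rightarrow> bool) \<Rightarrow> 'k \<Rightarrow> 'k \<Rightarrow> bool" where
  "constant_order lt x y \<longleftrightarrow> lt (hconst x) (hconst y)"

definition exponential :: "('a::field \<Rightarrow> 'a \<Rightarrow> bool) \<Rightarrow> ('a \<Rightarrow> 'a) \<Rightarrow> bool" where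
  "exponential lt f \<longleftrightarrow>
     bij_betw f UNIV {x. lt 0 x} \<and>
     (\<forall>x y. f (x + y) = f x * f y) \<and>
     (\<forall>x y. lt x y \<longleftrightarrow> lt (f x) (f y))"

definition valuation_ring :: "('g::linordered_ab_group_add, 'k::field) hahn set" where
  "valuation_ring = {a. hval a \<ge> 0}"

definition valuation_ideal :: "('g::linordered_ab_group_add, 'k::field) hahn set" where
  "valuation_ideal = {a. hval a > 0}"

definition positive_units ::
    "(('g::linordered_ab_group_add, 'k::field) hahn \<Rightarrow> ('g, 'k) hahn \<Rightarrow> bool) \<Rightarrow> ('g, 'k) hahn set" where
  "positive_units lt = {a. hval a = 0 \<and> lt 0 a}"

definition compatible_exponential ::
    "(('g::linordered_ab_group_add, 'k::field) hahn \<Rightarrow> ('g, 'k) hahn \<Rightarrow> bool) \<Rightarrow>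
     (('g, 'k) hahn \<Rightarrow> ('g, 'k) hahn) \<Rightarrow> bool" where
  "compatible_exponential lt f \<longleftrightarrow>
     exponential lt f \<and>
     f ` valuation_ring = positive_units lt \<and>
     f ` valuation_ideal = (\<lambda>a. 1 + a) ` valuation_ideal"

end

theory Submission
  imports Defs
begin

text \<open>
  Suppose that \<open>f\<close> is an exponential. Every positive element of \<open>K = k((G))\<close> is a square, namely
  \<open>f (x / 2)\<^sup>2\<close> for some \<open>x\<close>. A square has a leading coefficient that is a square and a least
  exponent that is divisible by \<open>2\<close>, so the order of \<open>K\<close> is forced to be the lexicographic one,
  given by the sign of the leading coefficient, and \<open>G\<close> is \<open>2\<close>-divisible. This makes the
  valuation convex without any appeal to Hensel's lemma
  (lemma \<open>exponential_positive_iff_hlead_and_even_hord\<close>).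

  If \<open>f\<close> is compatible, then it takes infinite positive elements, and only those among the
  positive ones, to infinite elements. Hence \<open>\<mu> y = w (f y)\<close> decreases strictly whenever \<open>y\<close> grows
  by an infinite amount, \<open>\<mu> y\<close> is negative for infinite positive \<open>y\<close>, and the values \<open>\<mu> (t\<^sup>v)\<close>
  with \<open>v < 0\<close> come arbitrarily close to \<open>0\<close> from below in \<open>G\<close>. Lemma
  \<open>no_antitone_map_to_exponents\<close> shows that no such \<open>\<mu>\<close> exists: \<open>K\<close> modulo its valuation ring
  contains a series for each well ordered set of negative exponents, and a map sending these series
  monotonically back to exponents would produce increasing families of exponents of every ordinal
  length, in the manner of Kurepa's theorem on the chain of well ordered subsets of a chain.

  If the constants are archimedean, the infinite positive elements are those that exceed every
  natural number. The rescaling \<open>F x = f (a * x)\<close> with \<open>f a = 2\<close> satisfies \<open>F n = 2\<^sup>n\<close>, so it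
  preserves these elements as well, and the same argument excludes \<open>F\<close>.
\<close>

section \<open>Least exponents and leading coefficients\<close>

definition hord :: "('g::linorder, 'k::zero) hahn \<Rightarrow> 'g" where
  "hord a = (LEAST g. g \<in> hsupp a)"

text \<open>
  The value \<open>hord 0\<close> is arbitrary, but \<open>hlead 0\<close> is \<open>0\<close>, so statements about the sign of a
  leading coefficient need no case distinction.
\<close>

definition hlead :: "('g::linorder, 'k::zero) hahn \<Rightarrow> 'k" where
  "hlead a = hcoeff a (hord a)"

lemma hord_eqI:
  assumes "hcoeff a g \<noteq> 0" "\<And>x. x < g \<Longrightarrow> hcoeff a x = 0"
  shows "hord a = g"
  unfolding hord_def using assms
  by (intro Least_equality) (auto simp: hsupp_def not_less[symmetric])

lemma hlead_eqI:
  assumes "hcoeff a g \<noteq> 0" "\<And>x. x < g \<Longrightarrow> hcoeff a x = 0"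
  shows "hlead a = hcoeff a g"
  using hord_eqI[OF assms] by (simp add: hlead_def)

lemma hord_least:
  fixes a :: "('g::linordered_ab_group_add, 'k::field) hahn"
  assumes "a \<noteq> 0"
  shows "hcoeff a (hord a) \<noteq> 0" "x < hord a \<Longrightarrow> hcoeff a x = 0"
proof -
  have "hsupp a \<noteq> {}"
    using assms hahn_eqI[of a 0] by (auto simp: hsupp_def zero_hahn.rep_eq)
  then obtain u where u: "u \<in> hsupp a" "\<And>x. x \<in> hsupp a \<Longrightarrow> u \<le> x"
    using wfp_on_less_obtain_least[OF wfp_on_hsupp order.refl] by metis
  have eq: "hord a = u" unfolding hord_def using u by (intro Least_equality) auto
  show "hcoeff a (hord a) \<noteq> 0" using u(1) eq by (simp add: hsupp_def)
  show "hcoeff a x = 0" if "x < hord a"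
    using u(2)[of x] that eq not_less by (force simp: hsupp_def)
qed

lemma hlead_eq_0_iff [simp]:
  fixes a :: "('g::linordered_ab_group_add, 'k::field) hahn"
  shows "hlead a = 0 \<longleftrightarrow> a = 0"
  using hord_least(1)[of a] by (auto simp: hlead_def zero_hahn.rep_eq)

lemma hlead_zero [simp]: "hlead (0 :: ('g::linordered_ab_group_add, 'k::field) hahn) = 0"
  by simp

lemma hord_hlead_hsingle:
  assumes "c \<noteq> 0"
  shows "hord (hsingle g c) = g" "hlead (hsingle g c) = c"
  using hord_eqI[of "hsingle g c" g] hlead_eqI[of "hsingle g c" g] assms
  by (auto simp: hsingle.rep_eq)

lemma hord_hlead_minus_dominated:
  fixes a b :: "('g::linordered_ab_group_add, 'k::field) hahn"
  assumes "a \<noteq> 0" "\<And>x. x \<le> hord a \<Longrightarrow> hcoeff b x = 0"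
  shows "hord (a - b) = hord a" "hlead (a - b) = hlead a"
proof -
  have "hcoeff (a - b) (hord a) \<noteq> 0" "\<And>x. x < hord a \<Longrightarrow> hcoeff (a - b) x = 0"
    using hord_least[OF assms(1)] assms(2) by (auto simp: minus_hahn.rep_eq)
  from hord_eqI[OF this] hlead_eqI[OF this] show "hord (a - b) = hord a" "hlead (a - b) = hlead a"
    by (simp_all add: hlead_def assms(2) minus_hahn.rep_eq)
qed

lemma hlead_uminus:
  fixes a :: "('g::linordered_ab_group_add, 'k::field) hahn"
  shows "hlead (- a) = - hlead a"
  by (simp add: hlead_def hord_def hsupp_def uminus_hahn.rep_eq)

lemma hord_uminus:
  fixes a :: "('g::linordered_ab_group_add, 'k::field) hahn"
  shows "hord (- a) = hord a"
  by (simp add: hord_def hsupp_def uminus_hahn.rep_eq)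

lemma hord_hlead_mult:
  fixes a b :: "('g::linordered_ab_group_add, 'k::field) hahn"
  assumes "a \<noteq> 0" "b \<noteq> 0"
  shows "hord (a * b) = hord a + hord b" "hlead (a * b) = hlead a * hlead b"
proof -
  have le: "hord c \<le> x" if "c \<noteq> 0" "x \<in> hsupp c" for c :: "('g, 'k) hahn" and x
    using hord_least(2)[OF that(1), of x] that(2) by (auto simp: hsupp_def not_less[symmetric])
  have "sum_pairs (hsupp a) (hsupp b) (hord a + hord b) = {(hord a, hord b)}"
  proof (intro set_eqI iffI)
    fix p assume "p \<in> sum_pairs (hsupp a) (hsupp b) (hord a + hord b)"
    then obtain x y where p: "p = (x, y)" "x \<in> hsupp a" "y \<in> hsupp b" "x + y = hord a + hord b"
      by (auto simp: sum_pairs_def)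
    have "x = hord a"
      using le[OF assms(1) p(2)] le[OF assms(2) p(3)] p(4) add_less_le_mono[of "hord a" x "hord b" y]
      by force
    then show "p \<in> {(hord a, hord b)}" using p by simp
  qed (use hord_least(1)[OF assms(1)] hord_least(1)[OF assms(2)] in
      \<open>auto simp: sum_pairs_def hsupp_def\<close>)
  then have top: "hcoeff (a * b) (hord a + hord b) = hlead a * hlead b"
    using hcoeff_times[OF wfp_on_hsupp wfp_on_hsupp order.refl order.refl, of a b "hord a + hord b"]
    by (simp add: hlead_def)
  have low: "hcoeff (a * b) x = 0" if "x < hord a + hord b" for x
  proof (rule ccontr)
    assume "hcoeff (a * b) x \<noteq> 0"
    then have "x \<in> hsupp (a * b)" by (simp add: hsupp_def)
    then obtain y z where "x = y + z" "y \<in> hsupp a" "z \<in> hsupp b"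
      using hsupp_times[of a b] by blast
    then show False using that le[OF assms(1), of y] le[OF assms(2), of z]
      by (meson add_mono not_less)
  qed
  have "hcoeff (a * b) (hord a + hord b) \<noteq> 0" using top assms by simp
  from hord_eqI[OF this low] hlead_eqI[OF this low] top
  show "hord (a * b) = hord a + hord b" "hlead (a * b) = hlead a * hlead b" by simp_all
qed

lemma one_hahn_lead:
  "hord (1 :: ('g::linordered_ab_group_add, 'k::field) hahn) = 0"
  "hlead (1 :: ('g::linordered_ab_group_add, 'k::field) hahn) = 1"
  by (simp_all add: one_hahn_def hord_hlead_hsingle)

lemma hconst_of_nat:
  "hconst (of_nat n) = (of_nat n :: ('g::linordered_ab_group_add, 'k::field) hahn)"
proof (induction n)
  case 0
  show ?case by (intro hahn_eqI) (simp add: hconst_def hsingle.rep_eq zero_hahn.rep_eq)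
next
  case (Suc n)
  have "hconst (of_nat (Suc n)) = 1 + (hconst (of_nat n) :: ('g, 'k) hahn)"
    by (intro hahn_eqI) (simp add: hconst_def one_hahn_def hsingle.rep_eq plus_hahn.rep_eq)
  then show ?case using Suc by simp
qed

lemma hval_eq_hord: "a \<noteq> 0 \<Longrightarrow> hval a = Fin (hord a)"
  by (simp add: hval_def hord_def)

definition hindicator :: "'g::linorder set \<Rightarrow> ('g, 'k::zero_neq_one) hahn" where
  "hindicator T = Abs_hahn (\<lambda>g. if g \<in> T then 1 else 0)"

lemma hcoeff_hindicator:
  assumes "wfp_on T (<)"
  shows "hcoeff (hindicator T :: ('g::linorder, 'k::zero_neq_one) hahn) g = (if g \<in> T then 1 else 0)"
  using assms by (simp add: hindicator_def Abs_hahn_inverse)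

section \<open>Order-reversing maps from series to exponents\<close>

text \<open>
  Write \<open>1\<^sub>T\<close> for the series with coefficient \<open>1\<close> exactly on \<open>T\<close>. If \<open>T\<close> grows inside the negative
  exponents, then \<open>1\<^sub>T\<close> grows by an infinite amount. Feeding the values \<open>\<mu> (t\<^sup>v - 1\<^sub>T)\<close> for smaller
  \<open>T\<close> back into \<open>T\<close> therefore yields transfinite increasing sequences of negative exponents, as
  long as \<open>t\<^sup>v - 1\<^sub>T\<close> stays positive infinite, which holds if all of \<open>T\<close> lies above \<open>v\<close>. A single
  sequence may violate this, since \<open>\<mu> (t\<^sup>v)\<close> can lie far below \<open>v\<close>. The remedy is to run countably
  many sequences \<open>g _ n\<close> at once, where \<open>T\<close> for the \<open>n\<close>-th is taken from the \<open>(n + 1)\<close>-th. These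
  take their start from exponents \<open>v n < 0\<close> with \<open>v n < \<mu> (t\<^bsup>v (n + 1)\<^esup>)\<close>, so that the values of the
  \<open>(n + 1)\<close>-th sequence lie above \<open>v n\<close>. The dependence on ever larger \<open>n\<close> is harmless because
  the recursion is on the ordinal index. Indexing by a well order of the power set of \<open>G\<close> gives an
  injection of that power set into \<open>G\<close>, against Cantor's theorem.
\<close>

lemma no_antitone_map_to_exponents:
  fixes \<mu> :: "('g::linordered_ab_group_add, 'k::linordered_field) hahn \<Rightarrow> 'g"
  assumes anti: "\<And>x y. 0 < hlead (y - x) \<Longrightarrow> hord (y - x) < 0 \<Longrightarrow> \<mu> y < \<mu> x"
    and zero: "\<mu> 0 = 0"
    and cofinal: "\<And>u. u < 0 \<Longrightarrow> \<exists>v<0. u < \<mu> (hsingle v 1)"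
  shows "\<not> (u::'g) < 0"
proof
  assume "u < 0"
  have "\<exists>v. \<forall>n. v n < 0 \<and> v n < \<mu> (hsingle (v (Suc n)) 1)"
    using \<open>u < 0\<close> cofinal dependent_nat_choice[of "\<lambda>_ v. v < 0" "\<lambda>_ v v'. v < \<mu> (hsingle v' 1)"]
    by blast
  then obtain v where v: "\<And>n. v n < 0" "\<And>n. v n < \<mu> (hsingle (v (Suc n)) 1)" by blast
  obtain r :: "'g set rel" where r: "well_order_on UNIV r" using well_order_on by blast
  define R where "R = r - Id"
  have wfR: "wf R" using r by (simp add: R_def well_order_on_def)
  have totR: "a = b \<or> (a, b) \<in> R \<or> (b, a) \<in> R" for a b
    using r by (auto simp: R_def well_order_on_def linear_order_on_def total_on_def)
  have transR: "trans R"
    using r unfolding R_def well_order_on_def linear_order_on_def partial_order_on_def preorder_on_def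
    by (simp add: trans_diff_Id)
  define g where "g = wfrec R (\<lambda>g a n.
    \<mu> (hsingle (v n) 1 - hindicator ((\<lambda>b. g b (Suc n)) ` {b. (b, a) \<in> R})))"
  define T where "T a n = (\<lambda>b. g b (Suc n)) ` {b. (b, a) \<in> R}" for a n
  define y where "y a n = hsingle (v n) 1 - (hindicator (T a n) :: ('g, 'k) hahn)" for a n
  have g: "g a n = \<mu> (y a n)" for a n
  proof -
    have "(\<lambda>b. cut g R a b (Suc n)) ` {b. (b, a) \<in> R} = T a n"
      unfolding T_def by (rule image_cong) (auto simp: cut_apply)
    then show ?thesis
      using fun_cong[OF def_wfrec[OF g_def[THEN eq_reflection] wfR, of a], of n] by (simp add: y_def)
  qed
  have main: "\<forall>n. v n < g a (Suc n) \<and> g a n < 0 \<and> (\<forall>b. (b, a) \<in> R \<longrightarrow> g b n < g a n)" for a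
  proof (induction a rule: wf_induct_rule[OF wfR])
    case (1 a)
    have Tbound: "v n < s \<and> s < 0" if "s \<in> T a n" for s n
      using that 1 by (auto simp: T_def)
    have wfT: "wfp_on (T a n) (<)" for n
      unfolding wfp_on_less_iff
    proof (intro allI impI)
      fix B assume B: "B \<subseteq> T a n" "B \<noteq> {}"
      define C where "C = {b. (b, a) \<in> R \<and> g b (Suc n) \<in> B}"
      have "C \<noteq> {}" using B by (auto simp: C_def T_def)
      then obtain c where c: "c \<in> C" "\<And>d. (d, c) \<in> R \<Longrightarrow> d \<notin> C"
        using wfE_min[OF wfR] by (metis ex_in_conv)
      have "g c (Suc n) \<le> z" if z: "z \<in> B" for z
      proof -
        obtain d where d: "d \<in> C" "z = g d (Suc n)" using z B by (auto simp: C_def T_def)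
        then have "d = c \<or> (c, d) \<in> R" using totR c(2) by blast
        then show ?thesis using d 1[of d] by (auto simp: C_def intro: less_imp_le)
      qed
      then show "\<exists>z\<in>B. \<forall>y\<in>B. z \<le> y" using c(1) by (auto simp: C_def)
    qed
    \<comment> \<open>Enlarging \<open>S\<close> subtracts more: the difference is the indicator of \<open>S' - S\<close>, whose least
      exponent is negative.\<close>
    have step: "\<mu> (z - hindicator S) < \<mu> (z - hindicator S')"
      if S: "S \<subset> S'" "S' \<subseteq> T a n" for z :: "('g, 'k) hahn" and S S' n
    proof -
      have w: "wfp_on S' (<)" "wfp_on S (<)" using wfp_on_subset[OF wfT[of n]] S by blast+
      obtain s where s: "s \<in> S' - S" "\<And>x. x \<in> S' - S \<Longrightarrow> s \<le> x"
        using wfp_on_less_obtain_least[OF w(1), of "S' - S"] S by blast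
      define d where "d = (z - hindicator S) - (z - hindicator S')"
      have d: "hcoeff d x = (if x \<in> S' - S then 1 else 0)" for x
        using S by (auto simp: d_def minus_hahn.rep_eq hcoeff_hindicator w)
      have "hcoeff d s \<noteq> 0" "\<And>x. x < s \<Longrightarrow> hcoeff d x = 0" using s d by fastforce+
      from hord_eqI[OF this] hlead_eqI[OF this] have "hord d = s" "hlead d = 1" using s d by auto
      then show ?thesis using Tbound[of s n] s S anti unfolding d_def by auto
    qed
    have h0: "hindicator {} = (0 :: ('g, 'k) hahn)"
      by (intro hahn_eqI) (simp add: hcoeff_hindicator wfp_on_less_iff zero_hahn.rep_eq)
    have A: "v n < g a (Suc n)" for n
    proof -
      have "\<mu> (hsingle (v (Suc n)) 1) \<le> g a (Suc n)"
      proof (cases "T a (Suc n) = {}")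
        case True then show ?thesis by (simp add: g y_def h0)
      next
        case False
        then show ?thesis using step[of "{}" "T a (Suc n)" "Suc n" "hsingle (v (Suc n)) 1"]
          by (simp add: g y_def h0 psubset_eq)
      qed
      then show ?thesis using v(2)[of n] by simp
    qed
    \<comment> \<open>As \<open>T a n\<close> lies above \<open>v n\<close>, the term \<open>t\<^bsup>v n\<^esup>\<close> dominates and \<open>y a n\<close> is positive infinite.\<close>
    have B: "g a n < 0" for n
    proof -
      have s: "hord (hsingle (v n) 1 :: ('g, 'k) hahn) = v n" "hlead (hsingle (v n) 1 :: ('g, 'k) hahn) = 1"
        by (simp_all add: hord_hlead_hsingle)
      have nz: "(hsingle (v n) 1 :: ('g, 'k) hahn) \<noteq> 0" by (metis s(2) hlead_eq_0_iff zero_neq_one)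
      have dom: "hcoeff (hindicator (T a n) :: ('g, 'k) hahn) x = 0"
        if "x \<le> hord (hsingle (v n) 1 :: ('g, 'k) hahn)" for x
        using that Tbound[of x n] by (auto simp: s hcoeff_hindicator wfT)
      have "hord (y a n - 0) = v n" "hlead (y a n - 0) = 1"
        using hord_hlead_minus_dominated[OF nz dom] s by (simp_all add: y_def)
      then show ?thesis using anti[of "y a n" 0] v(1)[of n] zero by (simp add: g)
    qed
    have C: "g b n < g a n" if b: "(b, a) \<in> R" for b n
    proof -
      have "T b n \<subseteq> T a n" using b transR by (auto simp: T_def dest: transD)
      moreover have "g b (Suc n) \<notin> T b n"
      proof
        assume "g b (Suc n) \<in> T b n"
        then obtain c where "(c, b) \<in> R" "g b (Suc n) = g c (Suc n)" by (auto simp: T_def)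
        then show False using 1[OF b] less_irrefl by metis
      qed
      moreover have "g b (Suc n) \<in> T a n" using b by (auto simp: T_def)
      ultimately show ?thesis using step[of "T b n" "T a n" n] by (auto simp: g y_def)
    qed
    show ?case using A B C by blast
  qed
  have "inj (\<lambda>a. g a 0)"
    using main totR by (intro injI) (metis less_irrefl)
  then have "surj (inv (\<lambda>a. g a 0))" by (rule inj_imp_surj_inv)
  then show False using Cantors_theorem[of UNIV] by auto
qed

section \<open>The order of a field with an exponential\<close>

text \<open>
  The order is a relation and not a type class operation, so the facts needed about it are restated
  in terms of the positive elements.
\<close>

lemma field_order_trichotomy:
  assumes "field_order lt"
  shows "lt x y \<longleftrightarrow> lt 0 (y - x)" "\<not> lt x x" "lt 0 x \<or> x = 0 \<or> lt 0 (- x)"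
    "lt 0 x \<Longrightarrow> \<not> lt 0 (- x)"
proof -
  interpret L: linorder "\<lambda>x y. x = y \<or> lt x y" lt using assms by (simp add: field_order_def)
  have add: "lt x y \<Longrightarrow> lt (x + z) (y + z)" for x y z using assms by (simp add: field_order_def)
  show d: "lt x y \<longleftrightarrow> lt 0 (y - x)" for x y using add[of x y "- x"] add[of 0 "y - x" x] by auto
  show "\<not> lt x x" by simp
  show "lt 0 x \<or> x = 0 \<or> lt 0 (- x)" using L.less_linear[of x 0] d[of x 0] by auto
  show "\<not> lt 0 (- x)" if "lt 0 x" using that d[of x 0] L.less_asym by auto
qed

lemma exponential_rules:
  assumes "field_order lt" "exponential lt f"
  shows "f (x + y) = f x * f y" "lt x y \<longleftrightarrow> lt (f x) (f y)" "lt 0 (f x)" "f x \<noteq> 0" "f 0 = 1"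
    "lt 0 z \<Longrightarrow> \<exists>x. f x = z" "f x = f y \<longleftrightarrow> x = y"
proof -
  have b: "bij_betw f UNIV {x. lt 0 x}" using assms(2) by (simp add: exponential_def)
  show add: "f (x + y) = f x * f y" for x y using assms(2) by (simp add: exponential_def)
  show "lt x y \<longleftrightarrow> lt (f x) (f y)" using assms(2) by (simp add: exponential_def)
  show pos: "lt 0 (f x)" for x using b by (auto simp: bij_betw_def)
  show nz: "f x \<noteq> 0" for x using pos[of x] field_order_trichotomy(2)[OF assms(1)] by metis
  show "f 0 = 1" using add[of 0 0] nz[of 0] by simp
  show "\<exists>x. f x = z" if "lt 0 z" using b that by (metis bij_betwE bij_betw_imp_surj_on imageE mem_Collect_eq)
  show "f x = f y \<longleftrightarrow> x = y" using b by (auto simp: bij_betw_def inj_def)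
qed

text \<open>
  Every element is a square or the negative of a square, since halving the logarithm takes square
  roots. A square has a positive leading coefficient in the ordered field of constants and an even
  least exponent.
\<close>

lemma exponential_positive_iff_hlead_and_even_hord:
  fixes lt :: "('g::linordered_ab_group_add, 'k::linordered_field) hahn \<Rightarrow> ('g, 'k) hahn \<Rightarrow> bool"
  assumes "field_order lt" "exponential lt f"
  shows "lt 0 x \<longleftrightarrow> 0 < hlead x" and "x \<noteq> 0 \<Longrightarrow> \<exists>h. hord x = h + h"
proof -
  note E = exponential_rules[OF assms] and O = field_order_trichotomy[OF assms(1)]
  have two: "(2 :: ('g, 'k) hahn) \<noteq> 0"
  proof
    assume "(2 :: ('g, 'k) hahn) = 0"
    then have "hconst (of_nat 2) = (0 :: ('g, 'k) hahn)"
      unfolding hconst_of_nat by simp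
    then have "hcoeff (hconst (of_nat 2) :: ('g, 'k) hahn) 0 = 0" by (simp add: zero_hahn.rep_eq)
    then show False by (simp add: hconst_def hsingle.rep_eq)
  qed
  have square: "0 < hlead z \<and> (\<exists>h. hord z = h + h)" if z: "lt 0 z" for z
  proof -
    obtain w where w: "f w = z" using E(6)[OF z] by blast
    have "w = w / 2 + w / 2" using two by (simp add: mult_2[symmetric])
    then have "z = f (w / 2) * f (w / 2)" using E(1)[of "w/2" "w/2"] w by simp
    moreover have "hlead (f (w / 2)) \<noteq> 0" using E(4) by simp
    ultimately show ?thesis using hord_hlead_mult[OF E(4) E(4), of "w / 2" "w / 2"]
      by (auto simp: zero_less_mult_iff not_less le_less)
  qed
  show "lt 0 x \<longleftrightarrow> 0 < hlead x"
    using square[of x] square[of "- x"] O(3)[of x] by (auto simp: hlead_uminus)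
  show "\<exists>h. hord x = h + h" if "x \<noteq> 0"
    using square[of x] square[of "- x"] O(3)[of x] that by (auto simp: hord_uminus)
qed

lemma hord_nonpos_if_greater_one:
  fixes z :: "('g::linordered_ab_group_add, 'k::linordered_field) hahn"
  assumes "0 < hlead (z - 1)" "z \<noteq> 0"
  shows "hord z \<le> 0"
proof (rule ccontr)
  assume "\<not> hord z \<le> 0"
  then have "hlead (1 - z) = 1"
    using hord_hlead_minus_dominated(2)[of 1 z] hord_least(2)[OF assms(2)] by (simp add: one_hahn_lead)
  then show False using assms(1) hlead_uminus[of "1 - z"] by simp
qed

text \<open>
  The argument shared by both halves of the theorem. Preservation of infinite elements in the two
  directions enters separately: from \<open>x\<close> to \<open>f x\<close> for strict monotonicity of \<open>w (f y)\<close>, and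
  backwards for the fact that \<open>w (f (t\<^sup>v))\<close> gets above any negative exponent.
\<close>

lemma no_exponential_preserving_infinite:
  fixes lt :: "('g::linordered_ab_group_add, 'k::linordered_field) hahn \<Rightarrow> ('g, 'k) hahn \<Rightarrow> bool"
  assumes nontrivial: "\<exists>g::'g. g \<noteq> 0"
    and lt: "field_order lt" and f: "exponential lt f"
    and inf: "\<And>x. lt 0 x \<Longrightarrow> hord (f x) < 0 \<longleftrightarrow> hord x < 0"
  shows False
proof -
  note E = exponential_rules[OF lt f] and O = field_order_trichotomy[OF lt]
    and P = exponential_positive_iff_hlead_and_even_hord[OF lt f]
  have anti: "hord (f y) < hord (f x)" if "0 < hlead (y - x)" "hord (y - x) < 0" for x y
  proof -
    have "f y = f x * f (y - x)" using E(1)[of x "y - x"] by simp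
    then have "hord (f y) = hord (f x) + hord (f (y - x))" using hord_hlead_mult(1)[OF E(4) E(4)] by simp
    then show ?thesis using inf[of "y - x"] that P by simp
  qed
  have cofinal: "\<exists>v<0. u < hord (f (hsingle v 1))" if u: "u < 0" for u :: 'g
  proof -
    have "lt 0 (hsingle u 1)" using P by (simp add: hord_hlead_hsingle)
    then obtain y where y: "f y = hsingle u 1" using E(6) by blast
    have fy: "hord (f y) = u" "hlead (f y) = 1" using y by (simp_all add: hord_hlead_hsingle)
    have "lt 1 (f y)"
    proof -
      have "hlead (f y - 1) = 1"
        using hord_hlead_minus_dominated(2)[OF E(4), of y 1] fy u
        by (auto simp: one_hahn_def hsingle.rep_eq)
      then show ?thesis using O(1) P by simp
    qed
    then have ypos: "lt 0 y" using E(2)[of 0 y] E(5) by simp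
    then have yinf: "hord y < 0" and ynz: "y \<noteq> 0" using inf fy u O(2) by auto
    \<comment> \<open>Halving gives an exponent strictly between that of \<open>y\<close> and \<open>0\<close>; then \<open>t\<^sup>h\<close> is infinitely
      smaller than \<open>y\<close> but still infinite.\<close>
    obtain h where h: "hord y = h + h" using P(2)[OF ynz] by blast
    have "h < 0" using yinf h by simp
    then have "hord y < h" using h by simp
    then have "hord (y - hsingle h 1) = hord y" "hlead (y - hsingle h 1) = hlead y"
      using hord_hlead_minus_dominated[OF ynz, of "hsingle h 1"] by (auto simp: hsingle.rep_eq)
    then have "u < hord (f (hsingle h 1))"
      using anti[of y "hsingle h 1"] yinf ypos P fy by simp
    then show ?thesis using \<open>h < 0\<close> by blast
  qed
  obtain u :: 'g where "u < 0" using nontrivial by (metis neg_less_0_iff_less not_less_iff_gr_or_eq)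
  then show False
    using no_antitone_map_to_exponents[of "\<lambda>x. hord (f x)" u] anti cofinal E(5)
    by (simp add: one_hahn_lead)
qed

section \<open>Compatible and archimedean exponentials\<close>

text \<open>
  For positive \<open>x\<close> the element \<open>f x\<close> exceeds \<open>1\<close>, so its value is at most \<open>0\<close>. This value is
  \<open>0\<close> iff \<open>f x\<close> lies in the image of the valuation ring, that is, by injectivity, iff \<open>x\<close> has
  nonnegative value.
\<close>

lemma compatible_exponential_preserves_infinite:
  fixes lt :: "('g::linordered_ab_group_add, 'k::linordered_field) hahn \<Rightarrow> ('g, 'k) hahn \<Rightarrow> bool"
  assumes lt: "field_order lt" and f: "compatible_exponential lt f" and x: "lt 0 x"
  shows "hord (f x) < 0 \<longleftrightarrow> hord x < 0"
proof -
  have f': "exponential lt f" using f by (simp add: compatible_exponential_def)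
  note E = exponential_rules[OF lt f'] and O = field_order_trichotomy[OF lt]
    and P = exponential_positive_iff_hlead_and_even_hord[OF lt f']
  have "lt 1 (f x)" using x E(2)[of 0 x] E(5) by simp
  then have "hord (f x) \<le> 0" using hord_nonpos_if_greater_one[OF _ E(4)] O(1) P by simp
  moreover have "hord (f x) = 0 \<longleftrightarrow> f x \<in> positive_units lt"
    using E(3,4) by (simp add: positive_units_def hval_eq_hord zero_extended_def)
  moreover have "f x \<in> positive_units lt \<longleftrightarrow> x \<in> valuation_ring"
  proof -
    have "inj f" using E(7) by (simp add: inj_def)
    then show ?thesis using f inj_image_mem_iff[of f x valuation_ring]
      by (simp add: compatible_exponential_def)
  qed
  moreover have "x \<in> valuation_ring \<longleftrightarrow> 0 \<le> hord x"
    using x O(2) by (auto simp: valuation_ring_def hval_def hord_def zero_extended_def)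
  ultimately show ?thesis by auto
qed

text \<open>
  An element of nonnegative value is bounded by a constant, and constants are bounded by natural
  numbers because their order is archimedean.
\<close>

lemma hord_neg_iff_greater_of_nats:
  fixes lt :: "('g::linordered_ab_group_add, 'k::linordered_field) hahn \<Rightarrow> ('g, 'k) hahn \<Rightarrow> bool"
  assumes lt: "field_order lt" and f: "exponential lt f"
    and arch: "archimedean_order (constant_order lt)" and x: "lt 0 x"
  shows "hord x < 0 \<longleftrightarrow> (\<forall>n. lt (of_nat n) x)"
proof -
  note O = field_order_trichotomy[OF lt] and P = exponential_positive_iff_hlead_and_even_hord[OF lt f]
  interpret L: linorder "\<lambda>x y. x = y \<or> lt x y" lt using lt by (simp add: field_order_def)
  have xnz: "x \<noteq> 0" using x O(2) by metis
  show ?thesis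
  proof
    assume neg: "hord x < 0"
    show "\<forall>n. lt (of_nat n) x"
    proof
      fix n
      have "hlead (x - hconst (of_nat n)) = hlead x"
        by (rule hord_hlead_minus_dominated(2)[OF xnz])
          (use neg in \<open>auto simp: hconst_def hsingle.rep_eq\<close>)
      then show "lt (of_nat n) x" using x O(1) P by (simp add: hconst_of_nat)
    qed
  next
    assume big: "\<forall>n. lt (of_nat n) x"
    show "hord x < 0"
    proof (rule ccontr)
      assume nn: "\<not> hord x < 0"
      \<comment> \<open>One more than the residue of \<open>x\<close>, so that \<open>hconst c - x\<close> has leading coefficient \<open>1\<close>.\<close>
      define c where "c = hcoeff x 0 + 1"
      have low: "hcoeff x g = 0" if "g < 0" for g using hord_least(2)[OF xnz, of g] that nn by simp
      have "hcoeff (hconst c - x) 0 = 1" "\<And>g. g < 0 \<Longrightarrow> hcoeff (hconst c - x) g = 0"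
        using low by (auto simp: minus_hahn.rep_eq hconst_def hsingle.rep_eq c_def)
      then have "hlead (hconst c - x) = 1" using hlead_eqI[of "hconst c - x" 0] by simp
      then have xc: "lt x (hconst c)" using O(1) P by simp
      obtain n where "lt (hconst c) (hconst (of_nat n))"
        using arch unfolding archimedean_order_def constant_order_def by blast
      then have "lt (hconst c) (of_nat n)" by (simp add: hconst_of_nat)
      then show False using xc big L.less_trans L.less_irrefl by blast
    qed
  qed
qed

text \<open>
  Nothing prevents \<open>f 1\<close> from being infinite, so \<open>f\<close> itself need not respect infinite elements.
  Rescaling the argument so that \<open>1\<close> goes to \<open>2\<close> repairs this: \<open>x\<close> exceeds every \<open>n\<close> iff \<open>F x\<close>
  exceeds every \<open>2\<^sup>n\<close>.
\<close>

lemma archimedean_no_exponential: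
  fixes lt :: "('g::linordered_ab_group_add, 'k::linordered_field) hahn \<Rightarrow> ('g, 'k) hahn \<Rightarrow> bool"
  assumes nontrivial: "\<exists>g::'g. g \<noteq> 0" and lt: "field_order lt"
    and arch: "archimedean_order (constant_order lt)"
  shows "\<not> exponential lt f"
proof
  assume f: "exponential lt f"
  note E = exponential_rules[OF lt f] and O = field_order_trichotomy[OF lt]
    and P = exponential_positive_iff_hlead_and_even_hord[OF lt f]
  interpret L: linorder "\<lambda>x y. x = y \<or> lt x y" lt using lt by (simp add: field_order_def)
  have one: "lt 0 1" using P by (simp add: one_hahn_lead)
  then have two: "lt 1 2" using O(1)[of 1 2] by simp
  then obtain a where a: "f a = 2" using E(6) L.less_trans one by blast
  have apos: "lt 0 a" using E(2)[of 0 a] E(5) a two by simp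
  have anz: "a \<noteq> 0" using apos O(2) by metis
  define F where "F x = f (a * x)" for x
  have scale: "lt 0 (a * x) \<longleftrightarrow> lt 0 x" for x
    using P apos hord_hlead_mult(2)[OF anz, of x] by (cases "x = 0") (auto simp: zero_less_mult_iff)
  have "exponential lt F"
    unfolding exponential_def
  proof (intro conjI allI)
    have "bij (\<lambda>x. a * x)" using anz by (intro bij_betw_byWitness[where f' = "\<lambda>x. x / a"]) auto
    from bij_betw_trans[OF this, of f "{x. lt 0 x}"] show "bij_betw F UNIV {x. lt 0 x}"
      using f by (simp add: exponential_def F_def[abs_def] comp_def)
    show "F (x + y) = F x * F y" for x y by (simp add: F_def distrib_left E(1))
    show "lt x y \<longleftrightarrow> lt (F x) (F y)" for x y
      using O(1)[of x y] O(1)[of "a * x" "a * y"] scale[of "y - x"] E(2)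
      by (simp add: F_def right_diff_distrib)
  qed
  note F = this exponential_rules[OF lt this] and hord_iff = hord_neg_iff_greater_of_nats[OF lt f arch]
  have Fnat: "F (of_nat n) = of_nat (2 ^ n)" for n
  proof (induction n)
    case (Suc n)
    have "F 1 = 2" by (simp add: F_def a)
    then show ?case using Suc F(2)[of 1 "of_nat n"] by simp
  qed (simp add: F(6))
  have nat_le: "of_nat m = (of_nat n :: ('g, 'k) hahn) \<or> lt (of_nat m) (of_nat n)" if "m \<le> n" for m n
    using that
  proof (induction rule: dec_induct)
    case (step n)
    have "lt (of_nat n :: ('g, 'k) hahn) (of_nat (Suc n))"
      using O(1)[of "of_nat n" "of_nat (Suc n)"] one by simp
    then show ?case using step.IH L.less_trans by metis
  qed simp
  have "hord (F x) < 0 \<longleftrightarrow> hord x < 0" if x: "lt 0 x" for x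
  proof -
    have "(\<forall>n. lt (of_nat n) (F x)) \<longleftrightarrow> (\<forall>n. lt (of_nat (2 ^ n)) (F x))"
      using nat_le[OF less_imp_le[OF less_exp]] L.less_trans by metis
    also have "\<dots> \<longleftrightarrow> (\<forall>n. lt (of_nat n) x)" using F(3)[of "of_nat _" x] by (simp only: Fnat)
    finally show ?thesis using hord_iff[OF x] hord_iff[OF F(4)[of x]] by simp
  qed
  then show False by (rule no_exponential_preserving_infinite[OF nontrivial lt F(1)])
qed

theorem theorem1:
  fixes lt :: "('g::linordered_ab_group_add, 'k::linordered_field) hahn \<Rightarrow> ('g, 'k) hahn \<Rightarrow> bool"
  assumes "\<exists>g::'g. g \<noteq> 0"
    and "field_order lt"
  shows "\<not> (\<exists>f. compatible_exponential lt f) \<and>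
    (archimedean_order (constant_order lt) \<longrightarrow> \<not> (\<exists>f. exponential lt f))"
proof (intro conjI impI notI)
  assume "\<exists>f. compatible_exponential lt f"
  then obtain f where f: "compatible_exponential lt f" by blast
  then have "exponential lt f" by (simp add: compatible_exponential_def)
  then show False
    using no_exponential_preserving_infinite[OF assms]
      compatible_exponential_preserves_infinite[OF assms(2) f] by blast
qed (use archimedean_no_exponential[OF assms] in blast)

end
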